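(* Let $Z=(z_{ij})_{1\le i,j\le n}$ be an IPR, and put $c_{ij}=\frac{z_{ij}^++z_{ij}^-}{2}$ and $l_{ij}=\ell(z_{ij})$. Consider the optimization problem $$(M)\qquad \min_{\overline{Z},\,u}\ \frac{1}{2n^2}\sum_{i=1}^n\sum_{j=1}^n\Big[(z_{ij}^+-\overline{z}_{ij}^+)^2+(z_{ij}^--\overline{z}_{ij}^-)^2\Big]$$ over all $u\in\mathcal{N}$ and all IPRs $\overline{Z}=(\overline{z}_{ij})$ of order $n$ subject to $\overline{z}_{ij}+u=\overline{z}_{ik}+\overline{z}_{kj}$ for all $i,j,k=1,\dots,n$. For $\nu=(\nu_1,\dots,\nu_n)\in\mathbb{R}^n$ and $\alpha\ge 0$ let $$F(\nu,\alpha)=\frac{1}{2n^2}\sum_{i=1}^n\sum_{j=1}^n\Big[(z_{ij}^+-(\nu_i-\nu_j+\alpha))^2+(z_{ij}^--(\nu_i-\nu_j-\alpha))^2\Big].$$ (1) Problem $(M)$ is equivalent to $\min_{\nu\in\mathbb{R}^n,\ \alpha\ge 0}F(\nu,\alpha)$, in the following sense: the feasible points of $(M)$ are exactly the pairs $(\overline{Z},u)$ with $u=[-\alpha,\alpha]$ and $\overline{z}_{ij}=[\nu_i-\nu_j-\alpha,\ \nu_i-\nu_j+\alpha]$ for all $i,j$, for some $\nu\in\mathbb{R}^n$ and $\alpha\ge 0$, and the objective value of $(M)$ at such a pair is $F(\nu,\alpha)$. (2) Consequently, any $(\nu^*,\alpha^* )$ with $$\nu_k^*=\frac1n\sum_{j=1}^n\nu_j^*+\frac1n\sum_{j=1}^n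 c_{kj}\quad (k=1,\dots,n),\qquad \alpha^*=\frac{1}{2n^2}\sum_{i=1}^n\sum_{j=1}^n l_{ij}$$ gives, through the correspondence in (1), an optimal solution of $(M)$. (3) For every fixed $\mu>0$, the problem of minimizing $F(\nu,\alpha)$ over $\nu\in\mathbb{R}^n$, $\alpha\ge0$ subject to $\frac1n\sum_{i=1}^n\nu_i=\mu$ has a unique solution, namely $$\nu_k^*=\mu+\frac1n\sum_{j=1}^n c_{kj}\quad (k=1,\dots,n),\qquad \alpha^*=\frac{1}{2n^2}\sum_{i=1}^n\sum_{j=1}^n l_{ij},$$ and this is also (through the correspondence in (1)) an optimal solution of $(M)$.
   Context: $\mathcal{I}(\mathbb{R})$ is the set of closed bounded intervals $z=[z^-,z^+]\subseteq\mathbb{R}$ with $z^-\le z^+$ (degenerate intervals $[a,a]$ allowed), and $\ell(z)=z^+-z^-$ is the length of $z$. Arithmetic: $z_1+z_2=\{x_1+x_2: x_1\in z_1, x_2\in z_2\}$ and $-z=[-z^+,-z^-]$. The set of neutral intervals is $\mathcal{N}=\{[-\varepsilon,\varepsilon]:\varepsilon\ge 0\}$. An interval preference relation (IPR) of order $n$ is an $n\times n$ matrix $Z=(z_{ij})$ with entries $z_{ij}\in\mathcal{I}(\mathbb{R})$ satisfying the reciprocity condition $z_{ij}=-z_{ji}$ for all $i,j=1,\dots,n$. *)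

theory Defs
  imports "HOL-Analysis.Analysis" "HOL-Library.Interval"
begin

text \<open>
  Closed bounded real intervals are the library type \<^typ>\<open>real interval\<close>, with endpoints
  \<^const>\<open>lower\<close> and \<^const>\<open>upper\<close>, length \<^const>\<open>width\<close>, and the library's interval addition
  and negation.  The order of a matrix is the cardinality of the finite index type \<open>'n\<close>.
  \<open>Interval (a, b)\<close> denotes the interval from \<open>a\<close> to \<open>b\<close> only if \<open>a \<le> b\<close>; it is used
  below only with \<open>\<alpha> \<ge> 0\<close>.
\<close>

definition neutral_intervals :: "real interval set" where
  "neutral_intervals = {Interval (- \<epsilon>, \<epsilon>) | \<epsilon>. \<epsilon> \<ge> 0}"

definition is_IPR :: "real interval ^ 'n ^ 'n \<Rightarrow> bool" where
  "is_IPR Z \<longleftrightarrow> (\<forall>i j. Z $ i $ j = - (Z $ j $ i))"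

definition center :: "real interval \<Rightarrow> real" where
  "center z = (upper z + lower z) / 2"

definition M_feasible :: "(real interval ^ 'n ^ 'n) \<times> real interval \<Rightarrow> bool" where
  "M_feasible = (\<lambda>(Zb, u). is_IPR Zb \<and> u \<in> neutral_intervals \<and>
     (\<forall>i j k. Zb $ i $ j + u = Zb $ i $ k + Zb $ k $ j))"

definition M_objective ::
    "real interval ^ 'n ^ 'n \<Rightarrow> (real interval ^ 'n ^ 'n) \<times> real interval \<Rightarrow> real" where
  "M_objective Z = (\<lambda>(Zb, u). 1 / (2 * (real CARD('n))\<^sup>2) *
     (\<Sum>i\<in>UNIV. \<Sum>j\<in>UNIV. (upper (Z $ i $ j) - upper (Zb $ i $ j))\<^sup>2
                       + (lower (Z $ i $ j) - lower (Zb $ i $ j))\<^sup>2))"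

definition F_objective :: "real interval ^ 'n ^ 'n \<Rightarrow> (real ^ 'n) \<times> real \<Rightarrow> real" where
  "F_objective Z = (\<lambda>(\<nu>, \<alpha>). 1 / (2 * (real CARD('n))\<^sup>2) *
     (\<Sum>i\<in>UNIV. \<Sum>j\<in>UNIV. (upper (Z $ i $ j) - (\<nu> $ i - \<nu> $ j + \<alpha>))\<^sup>2
                       + (lower (Z $ i $ j) - (\<nu> $ i - \<nu> $ j - \<alpha>))\<^sup>2))"

definition M_point :: "(real ^ 'n) \<times> real \<Rightarrow> (real interval ^ 'n ^ 'n) \<times> real interval" where
  "M_point = (\<lambda>(\<nu>, \<alpha>).
     ((\<chi> i j. Interval (\<nu> $ i - \<nu> $ j - \<alpha>, \<nu> $ i - \<nu> $ j + \<alpha>)), Interval (- \<alpha>, \<alpha>)))"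

end

theory Submission
  imports Defs
begin

text \<open>
  Write \<open>c\<close> and \<open>w\<close> for the centers and the half widths of \<open>Z\<close>.  By the parallelogram
  law the objective splits into a term in \<open>\<nu>\<close> and a term in \<open>\<alpha>\<close>, namely the squared distances
  from \<open>c\<close> to the matrix of differences of \<open>\<nu>\<close> and from \<open>w\<close> to the constant matrix \<open>\<alpha>\<close>.
  The row means of \<open>c\<close> and the mean of \<open>w\<close> are the orthogonal projections, so \<open>F\<close> exceeds its
  value there by an explicit sum of squares, which gives both optimality and uniqueness.
\<close>

section \<open>Endpoints, lengths and reciprocity of intervals\<close>

lemma lower_Interval [simp]: "a \<le> b \<Longrightarrow> lower (Interval (a, b)) = a"
  and upper_Interval [simp]: "a \<le> b \<Longrightarrow> upper (Interval (a, b)) = b"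
  by (simp_all add: lower.rep_eq upper.rep_eq Interval_inverse)

lemma width_nonneg: "width (z :: real interval) \<ge> 0"
  using lower_le_upper[of z] by (simp add: width_def)

lemma is_IPR_center:
  assumes "is_IPR Z"
  shows "center (Z $ j $ i) = - center (Z $ i $ j)"
proof -
  have "Z $ j $ i = - (Z $ i $ j)"
    using assms unfolding is_IPR_def by blast
  then show ?thesis
    by (simp add: center_def field_simps)
qed

section \<open>Parametrization of the feasible set\<close>

lemma M_feasible_M_point:
  assumes "\<alpha> \<ge> 0"
  shows "M_feasible (M_point (\<nu>, \<alpha>))"
proof -
  have "Interval (- \<alpha>, \<alpha>) \<in> neutral_intervals"
    using assms by (auto simp: neutral_intervals_def)
  with assms show ?thesis
    by (simp add: M_feasible_def M_point_def is_IPR_def interval_eq_iff)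
qed

text \<open>Reciprocity lets the upper endpoints determine the lower ones. For upper endpoints the
  constraint is a cocycle equation up to the shift \<alpha>, so they are differences of a potential,
  which can be read off from a single column.\<close>

lemma M_feasible_imp_M_point:
  fixes Zb :: "real interval ^ 'n ^ 'n"
  assumes "M_feasible (Zb, u)"
  shows "\<exists>\<nu> \<alpha>. \<alpha> \<ge> 0 \<and> (Zb, u) = M_point (\<nu>, \<alpha>)"
proof -
  from assms obtain \<alpha> where \<alpha>: "\<alpha> \<ge> 0" and u: "u = Interval (- \<alpha>, \<alpha>)"
    and ipr: "is_IPR Zb"
    and sum: "\<And>i j k. Zb $ i $ j + u = Zb $ i $ k + Zb $ k $ j"
    by (auto simp: M_feasible_def neutral_intervals_def)
  have up: "upper (Zb $ i $ j) + \<alpha> = upper (Zb $ i $ k) + upper (Zb $ k $ j)" for i j k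
    using arg_cong[OF sum[of i j k], of upper] \<alpha> by (simp add: u)
  have lo: "lower (Zb $ i $ j) = - upper (Zb $ j $ i)" for i j
  proof -
    have "Zb $ i $ j = - (Zb $ j $ i)"
      using ipr unfolding is_IPR_def by blast
    then show ?thesis by simp
  qed
  \<comment> \<open>Any fixed index serves; another choice changes \<open>\<nu>\<close> by an
    additive constant only.\<close>
  define k where "k = (undefined :: 'n)"
  define \<nu> where "\<nu> = (\<chi> i. upper (Zb $ i $ k) - \<alpha>)"
  \<comment> \<open>The instance \<open>k k k\<close> makes the diagonal upper endpoint equal to
    \<alpha>, and \<open>k k j\<close> then expresses the entry at (k, j) through the one at (j,
    k).\<close>
  have upper_eq: "upper (Zb $ i $ j) = \<nu> $ i - \<nu> $ j + \<alpha>" for i j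
    using up[of i j k] up[of k k j] up[of k k k] by (simp add: \<nu>_def)
  have "Zb $ i $ j = Interval (\<nu> $ i - \<nu> $ j - \<alpha>, \<nu> $ i - \<nu> $ j + \<alpha>)" for i j
    using \<alpha> by (simp add: interval_eq_iff lo upper_eq)
  then have "(Zb, u) = M_point (\<nu>, \<alpha>)"
    by (simp add: M_point_def u vec_eq_iff)
  with \<alpha> show ?thesis by blast
qed

lemma M_feasible_eq_M_point:
  "{p. M_feasible p} = {M_point (\<nu>, \<alpha>) | (\<nu> :: real ^ 'n) \<alpha>. \<alpha> \<ge> 0}"
proof (intro equalityI subsetI; clarsimp)
  fix Zb :: "real interval ^ 'n ^ 'n" and u
  assume "M_feasible (Zb, u)"
  then show "\<exists>\<nu> \<alpha>. (Zb, u) = M_point (\<nu>, \<alpha>) \<and> \<alpha> \<ge> 0"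
    using M_feasible_imp_M_point by blast
qed (rule M_feasible_M_point)

lemma M_objective_M_point:
  assumes "\<alpha> \<ge> 0"
  shows "M_objective Z (M_point (\<nu>, \<alpha>)) = F_objective Z (\<nu>, \<alpha>)"
  using assms by (simp add: M_objective_def M_point_def F_objective_def)

section \<open>Orthogonal splitting of the objective\<close>

lemma F_objective_center_width:
  fixes Z :: "real interval ^ 'n ^ 'n"
  shows "F_objective Z (\<nu>, \<alpha>) = 1 / (real CARD('n))\<^sup>2 *
    ((\<Sum>i\<in>UNIV. \<Sum>j\<in>UNIV. (center (Z $ i $ j) - (\<nu> $ i - \<nu> $ j))\<^sup>2)
     + (\<Sum>i\<in>UNIV. \<Sum>j\<in>UNIV. (width (Z $ i $ j) / 2 - \<alpha>)\<^sup>2))"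
proof -
  \<comment> \<open>The endpoints are center plus and minus half the width, so this is the
    parallelogram law; the factor 2 cancels the one in the denominator of the objective.\<close>
  have term_eq: "(upper z - (d + \<alpha>))\<^sup>2 + (lower z - (d - \<alpha>))\<^sup>2
      = 2 * ((center z - d)\<^sup>2 + (width z / 2 - \<alpha>)\<^sup>2)" for z d
    by (simp add: center_def width_def power2_eq_square field_simps)
  show ?thesis
    unfolding F_objective_def prod.case term_eq
    unfolding sum_distrib_left[symmetric] sum.distrib
    by (simp add: add_divide_distrib)
qed

text \<open>The centers form an antisymmetric matrix, so exchanging the indices negates the double
  sum.\<close>

lemma sum_sum_center_eq_0:
  fixes Z :: "real interval ^ 'n ^ 'n"
  assumes "is_IPR Z"
  shows "(\<Sum>i\<in>UNIV. \<Sum>j\<in>UNIV. center (Z $ i $ j)) = 0"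
proof -
  have "(\<Sum>i\<in>UNIV. \<Sum>j\<in>UNIV. center (Z $ i $ j)) = (\<Sum>j\<in>UNIV. \<Sum>i\<in>UNIV. center (Z $ i $ j))"
    by (rule sum.swap)
  also have "\<dots> = (\<Sum>j\<in>UNIV. \<Sum>i\<in>UNIV. - center (Z $ j $ i))"
    by (intro sum.cong refl is_IPR_center[OF assms])
  also have "\<dots> = - (\<Sum>i\<in>UNIV. \<Sum>j\<in>UNIV. center (Z $ i $ j))"
    by (simp add: sum_negf)
  finally show ?thesis by simp
qed

text \<open>Pythagoras. Double sums are brought into this form by summing over
  \<open>UNIV \<times> UNIV\<close>.\<close>

lemma sum_power2_shift:
  fixes f g :: "'a \<Rightarrow> 'b :: comm_ring_1"
  assumes "(\<Sum>x\<in>A. f x * g x) = 0"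
  shows "(\<Sum>x\<in>A. (f x + g x)\<^sup>2) = (\<Sum>x\<in>A. (f x)\<^sup>2) + (\<Sum>x\<in>A. (g x)\<^sup>2)"
proof -
  have "(\<Sum>x\<in>A. (f x + g x)\<^sup>2) = (\<Sum>x\<in>A. (f x)\<^sup>2) + (\<Sum>x\<in>A. (g x)\<^sup>2) + 2 * (\<Sum>x\<in>A. f x * g x)"
    by (simp add: power2_sum sum.distrib sum_distrib_left mult.assoc)
  with assms show ?thesis by simp
qed

text \<open>The residual \<open>D\<close> is antisymmetric with zero row sums, hence orthogonal to
  every matrix of differences. The offset \<open>m\<close> is left open to cover both the mean of
  \<nu> itself and a prescribed mean.\<close>

lemma sum_center_power2:
  fixes Z :: "real interval ^ 'n ^ 'n" and \<nu> \<nu>' :: "real ^ 'n"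
  assumes Z: "is_IPR Z"
    and \<nu>: "\<And>k. \<nu> $ k = m + 1 / real CARD('n) * (\<Sum>j\<in>UNIV. center (Z $ k $ j))"
  shows "(\<Sum>i\<in>UNIV. \<Sum>j\<in>UNIV. (center (Z $ i $ j) - (\<nu>' $ i - \<nu>' $ j))\<^sup>2)
    = (\<Sum>i\<in>UNIV. \<Sum>j\<in>UNIV. (center (Z $ i $ j) - (\<nu> $ i - \<nu> $ j))\<^sup>2)
      + (\<Sum>i\<in>UNIV. \<Sum>j\<in>UNIV. ((\<nu> - \<nu>') $ i - (\<nu> - \<nu>') $ j)\<^sup>2)"
proof -
  define e where "e = \<nu> - \<nu>'"
  define D where "D i j = center (Z $ i $ j) - (\<nu> $ i - \<nu> $ j)" for i j
  have row_mean: "(\<Sum>j\<in>UNIV. center (Z $ i $ j)) = real CARD('n) * (\<nu> $ i - m)" for i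
    using \<nu>[of i] by (simp add: field_simps)
  \<comment> \<open>Adding up all rows identifies \<open>m\<close> as the mean of \<nu>, which is
    what makes the row sums of \<open>D\<close> vanish.\<close>
  have "real CARD('n) * (\<Sum>i\<in>UNIV. \<nu> $ i - m) = 0"
    using sum_sum_center_eq_0[OF Z] unfolding row_mean sum_distrib_left .
  then have mean: "(\<Sum>i\<in>UNIV. \<nu> $ i) = real CARD('n) * m"
    by (simp add: sum_subtractf)
  have row: "(\<Sum>j\<in>UNIV. D i j) = 0" for i
    unfolding D_def sum_subtractf by (simp add: row_mean mean algebra_simps)
  have D_anti: "D j i = - D i j" for i j
    using is_IPR_center[OF Z, of j i] by (simp add: D_def)
  have rows: "(\<Sum>i\<in>UNIV. \<Sum>j\<in>UNIV. D i j * e $ i) = 0"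
    by (simp add: row flip: sum_distrib_right)
  \<comment> \<open>Antisymmetry turns column sums into negated row sums, so this half of the cross
    term reduces to \<open>rows\<close>.\<close>
  have "(\<Sum>i\<in>UNIV. \<Sum>j\<in>UNIV. D i j * e $ j) = (\<Sum>j\<in>UNIV. \<Sum>i\<in>UNIV. D i j * e $ j)"
    by (rule sum.swap)
  also have "\<dots> = (\<Sum>j\<in>UNIV. \<Sum>i\<in>UNIV. - (D j i * e $ j))"
    by (intro sum.cong refl) (metis D_anti mult_minus_left)
  also have "\<dots> = 0"
    using rows by (simp add: sum_negf)
  finally have "(\<Sum>i\<in>UNIV. \<Sum>j\<in>UNIV. D i j * (e $ i - e $ j)) = 0"
    using rows by (simp add: right_diff_distrib sum_subtractf)
  then have "(\<Sum>x\<in>UNIV \<times> UNIV. case x of (i, j) \<Rightarrow> D i j * (e $ i - e $ j)) = 0"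
    by (simp add: sum.cartesian_product)
  then have cross: "(\<Sum>x\<in>UNIV \<times> UNIV. case_prod D x * (e $ fst x - e $ snd x)) = 0"
    by (simp add: case_prod_beta)
  have shift: "center (Z $ i $ j) - (\<nu>' $ i - \<nu>' $ j) = D i j + (e $ i - e $ j)" for i j
    by (simp add: D_def e_def)
  show ?thesis
    using sum_power2_shift[OF cross]
    unfolding shift D_def[symmetric] e_def[symmetric]
    by (simp add: sum.cartesian_product case_prod_beta)
qed

text \<open>The 2 in the denominator makes \<alpha> the mean of the half widths. The residual
  therefore sums to zero and is orthogonal to constant matrices.\<close>

lemma sum_width_power2:
  fixes Z :: "real interval ^ 'n ^ 'n"
  assumes \<alpha>: "\<alpha> = 1 / (2 * (real CARD('n))\<^sup>2) * (\<Sum>i\<in>UNIV. \<Sum>j\<in>UNIV. width (Z $ i $ j))"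
  shows "(\<Sum>i\<in>UNIV. \<Sum>j\<in>UNIV. (width (Z $ i $ j) / 2 - \<alpha>')\<^sup>2)
    = (\<Sum>i\<in>UNIV. \<Sum>j\<in>UNIV. (width (Z $ i $ j) / 2 - \<alpha>)\<^sup>2)
      + (real CARD('n))\<^sup>2 * (\<alpha> - \<alpha>')\<^sup>2"
proof -
  define g where "g x = width (Z $ fst x $ snd x) / 2 - \<alpha>" for x
  have "(\<Sum>i\<in>UNIV. \<Sum>j\<in>UNIV. width (Z $ i $ j) / 2 - \<alpha>) = 0"
    by (simp add: \<alpha> sum_subtractf power2_eq_square flip: sum_divide_distrib)
  then have "(\<Sum>x\<in>UNIV \<times> UNIV. g x) = 0"
    by (simp add: g_def sum.cartesian_product case_prod_beta)
  then have cross: "(\<Sum>x\<in>UNIV \<times> UNIV. g x * (\<alpha> - \<alpha>')) = 0"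
    by (simp flip: sum_distrib_right)
  have shift: "width (Z $ fst x $ snd x) / 2 - \<alpha>' = g x + (\<alpha> - \<alpha>')" for x
    by (simp add: g_def)
  show ?thesis
    using sum_power2_shift[OF cross]
    by (simp add: sum.cartesian_product case_prod_beta shift
        power2_eq_square[of "real CARD('n)"] flip: g_def)
qed

section \<open>Minimality and uniqueness for \<open>F_objective\<close>\<close>

lemma F_objective_excess:
  fixes Z :: "real interval ^ 'n ^ 'n" and \<nu> \<nu>' :: "real ^ 'n"
  assumes Z: "is_IPR Z"
    and \<nu>: "\<And>k. \<nu> $ k = m + 1 / real CARD('n) * (\<Sum>j\<in>UNIV. center (Z $ k $ j))"
    and \<alpha>: "\<alpha> = 1 / (2 * (real CARD('n))\<^sup>2) * (\<Sum>i\<in>UNIV. \<Sum>j\<in>UNIV. width (Z $ i $ j))"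
  shows "F_objective Z (\<nu>', \<alpha>') = F_objective Z (\<nu>, \<alpha>)
    + (1 / (real CARD('n))\<^sup>2 * (\<Sum>i\<in>UNIV. \<Sum>j\<in>UNIV. ((\<nu> - \<nu>') $ i - (\<nu> - \<nu>') $ j)\<^sup>2)
       + (\<alpha> - \<alpha>')\<^sup>2)"
  unfolding F_objective_center_width sum_center_power2[OF Z \<nu>, of \<nu>']
    sum_width_power2[OF \<alpha>, of \<alpha>']
  by (simp add: add_divide_distrib)

lemma F_objective_min:
  fixes Z :: "real interval ^ 'n ^ 'n" and \<nu> \<nu>' :: "real ^ 'n"
  assumes "is_IPR Z"
    and "\<And>k. \<nu> $ k = m + 1 / real CARD('n) * (\<Sum>j\<in>UNIV. center (Z $ k $ j))"
    and "\<alpha> = 1 / (2 * (real CARD('n))\<^sup>2) * (\<Sum>i\<in>UNIV. \<Sum>j\<in>UNIV. width (Z $ i $ j))"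
  shows "F_objective Z (\<nu>, \<alpha>) \<le> F_objective Z (\<nu>', \<alpha>')"
  unfolding F_objective_excess[OF assms, of \<nu>' \<alpha>'] by (simp add: sum_nonneg)

text \<open>Zero excess determines \<alpha>, but \<nu> only up to an additive constant, since only
  differences of \<nu> enter. Equality of the coordinate sums removes this freedom.\<close>

lemma F_objective_min_unique:
  fixes Z :: "real interval ^ 'n ^ 'n" and \<nu> \<nu>' :: "real ^ 'n"
  assumes "is_IPR Z"
    and "\<And>k. \<nu> $ k = m + 1 / real CARD('n) * (\<Sum>j\<in>UNIV. center (Z $ k $ j))"
    and "\<alpha> = 1 / (2 * (real CARD('n))\<^sup>2) * (\<Sum>i\<in>UNIV. \<Sum>j\<in>UNIV. width (Z $ i $ j))"
    and le: "F_objective Z (\<nu>', \<alpha>') \<le> F_objective Z (\<nu>, \<alpha>)"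
    and mean: "(\<Sum>i\<in>UNIV. \<nu>' $ i) = (\<Sum>i\<in>UNIV. \<nu> $ i)"
  shows "\<nu>' = \<nu>" "\<alpha>' = \<alpha>"
proof -
  define e where "e = \<nu> - \<nu>'"
  define S where "S = (\<Sum>i\<in>UNIV. \<Sum>j\<in>UNIV. (e $ i - e $ j)\<^sup>2)"
  have "1 / (real CARD('n))\<^sup>2 * S \<ge> 0"
    by (simp add: S_def sum_nonneg)
  moreover have "1 / (real CARD('n))\<^sup>2 * S + (\<alpha> - \<alpha>')\<^sup>2 \<le> 0"
    using le unfolding F_objective_excess[OF assms(1-3), of \<nu>' \<alpha>'] S_def e_def by simp
  ultimately have "1 / (real CARD('n))\<^sup>2 * S = 0" and "(\<alpha> - \<alpha>')\<^sup>2 = 0"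
    using zero_le_power2[of "\<alpha> - \<alpha>'"] by linarith+
  then have "S = 0" and "\<alpha>' = \<alpha>"
    by simp_all
  from \<open>\<alpha>' = \<alpha>\<close> show "\<alpha>' = \<alpha>" .
  \<comment> \<open>A vanishing sum of squares has only zero terms, so \<open>e\<close> is
    constant.\<close>
  have e_eq: "e $ j = e $ i" for i j
    using \<open>S = 0\<close> by (simp add: S_def sum_nonneg_eq_0_iff sum_nonneg)
  have "e $ i = 0" for i
  proof -
    have "real CARD('n) * e $ i = (\<Sum>j\<in>(UNIV :: 'n set). e $ i)"
      by simp
    also have "\<dots> = (\<Sum>j\<in>UNIV. e $ j)"
      by (intro sum.cong refl e_eq)
    also have "\<dots> = 0"
      using mean by (simp add: e_def sum_subtractf)
    finally show ?thesis by simp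
  qed
  then show "\<nu>' = \<nu>"
    by (simp add: e_def vec_eq_iff)
qed

section \<open>Optimal solutions of both problems\<close>

lemma is_arg_min_M_point:
  fixes Z :: "real interval ^ 'n ^ 'n" and \<nu> :: "real ^ 'n"
  assumes "is_IPR Z"
    and "\<And>k. \<nu> $ k = m + 1 / real CARD('n) * (\<Sum>j\<in>UNIV. center (Z $ k $ j))"
    and \<alpha>: "\<alpha> = 1 / (2 * (real CARD('n))\<^sup>2) * (\<Sum>i\<in>UNIV. \<Sum>j\<in>UNIV. width (Z $ i $ j))"
  shows "is_arg_min (M_objective Z) M_feasible (M_point (\<nu>, \<alpha>))"
proof -
  \<comment> \<open>Nonnegativity ensures that \<open>M_point\<close> consists of genuine intervals,
    so that it is feasible and the two objectives agree on it.\<close>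
  have "\<alpha> \<ge> 0"
    unfolding \<alpha> by (simp add: sum_nonneg width_nonneg)
  moreover have "M_objective Z (M_point (\<nu>, \<alpha>)) \<le> M_objective Z p" if feasible: "M_feasible p" for p
  proof -
    obtain \<nu>' \<alpha>' where p: "p = M_point (\<nu>', \<alpha>')" and "\<alpha>' \<ge> 0"
      using M_feasible_imp_M_point[of "fst p" "snd p"] feasible by auto
    show ?thesis
      unfolding p M_objective_M_point[OF \<open>\<alpha> \<ge> 0\<close>] M_objective_M_point[OF \<open>\<alpha>' \<ge> 0\<close>]
      by (rule F_objective_min[OF assms])
  qed
  ultimately show ?thesis
    unfolding is_arg_min_linorder using M_feasible_M_point by blast
qed

lemma is_arg_min_F_objective_iff:
  fixes Z :: "real interval ^ 'n ^ 'n" and \<nu> :: "real ^ 'n"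
  assumes Z: "is_IPR Z"
    and \<nu>: "\<And>k. \<nu> $ k = \<mu> + 1 / real CARD('n) * (\<Sum>j\<in>UNIV. center (Z $ k $ j))"
    and \<alpha>: "\<alpha> = 1 / (2 * (real CARD('n))\<^sup>2) * (\<Sum>i\<in>UNIV. \<Sum>j\<in>UNIV. width (Z $ i $ j))"
  shows "is_arg_min (F_objective Z)
      (\<lambda>(\<nu>', \<alpha>'). \<alpha>' \<ge> 0 \<and> 1 / real CARD('n) * (\<Sum>i\<in>UNIV. \<nu>' $ i) = \<mu>) p
    \<longleftrightarrow> p = (\<nu>, \<alpha>)" (is "is_arg_min _ ?P p \<longleftrightarrow> _")
proof
  \<comment> \<open>The row means of the centers cancel in total, so the candidate meets the
    constraint on the mean.\<close>
  have "(\<Sum>i\<in>UNIV. \<nu> $ i) = real CARD('n) * \<mu>"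
    using sum_sum_center_eq_0[OF Z]
    by (simp add: \<nu> sum.distrib flip: sum_divide_distrib)
  then have mean: "1 / real CARD('n) * (\<Sum>i\<in>UNIV. \<nu> $ i) = \<mu>" by simp
  have "\<alpha> \<ge> 0"
    unfolding \<alpha> by (simp add: sum_nonneg width_nonneg)
  with mean have P: "?P (\<nu>, \<alpha>)" by simp
  show "is_arg_min (F_objective Z) ?P p" if "p = (\<nu>, \<alpha>)"
    using P F_objective_min[OF assms] that by (auto simp: is_arg_min_linorder)
  show "p = (\<nu>, \<alpha>)" if min: "is_arg_min (F_objective Z) ?P p"
  proof -
    obtain \<nu>' \<alpha>' where p: "p = (\<nu>', \<alpha>')" by fastforce
    have "F_objective Z (\<nu>', \<alpha>') \<le> F_objective Z (\<nu>, \<alpha>)"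
      using min P unfolding is_arg_min_linorder p by blast
    moreover have "(\<Sum>i\<in>UNIV. \<nu>' $ i) = (\<Sum>i\<in>UNIV. \<nu> $ i)"
      using min mean by (simp add: is_arg_min_linorder p field_simps)
    ultimately show ?thesis
      using F_objective_min_unique[OF assms] by (simp add: p)
  qed
qed

theorem theorem3:
  fixes Z :: "real interval ^ 'n ^ 'n"
  assumes "is_IPR Z"
  shows
    "({p. M_feasible p} = {M_point (\<nu>, \<alpha>) | (\<nu> :: real ^ 'n) \<alpha>. \<alpha> \<ge> 0} \<and>
      (\<forall>(\<nu> :: real ^ 'n) \<alpha>. \<alpha> \<ge> 0 \<longrightarrow>
         M_objective Z (M_point (\<nu>, \<alpha>)) = F_objective Z (\<nu>, \<alpha>)))
     \<and>
     (\<forall>(\<nu> :: real ^ 'n) \<alpha>.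
        (\<forall>k. \<nu> $ k = 1 / real CARD('n) * (\<Sum>j\<in>UNIV. \<nu> $ j)
                   + 1 / real CARD('n) * (\<Sum>j\<in>UNIV. center (Z $ k $ j))) \<and>
        \<alpha> = 1 / (2 * (real CARD('n))\<^sup>2) * (\<Sum>i\<in>UNIV. \<Sum>j\<in>UNIV. width (Z $ i $ j))
        \<longrightarrow> is_arg_min (M_objective Z) M_feasible (M_point (\<nu>, \<alpha>)))
     \<and>
     (\<forall>\<mu> > 0.
        let \<nu> = (\<chi> k. \<mu> + 1 / real CARD('n) * (\<Sum>j\<in>UNIV. center (Z $ k $ j)));
            \<alpha> = 1 / (2 * (real CARD('n))\<^sup>2) * (\<Sum>i\<in>UNIV. \<Sum>j\<in>UNIV. width (Z $ i $ j))
        in (\<forall>p. is_arg_min (F_objective Z)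
                  (\<lambda>(\<nu>', \<alpha>'). \<alpha>' \<ge> 0 \<and> 1 / real CARD('n) * (\<Sum>i\<in>UNIV. \<nu>' $ i) = \<mu>) p
                \<longleftrightarrow> p = (\<nu>, \<alpha>)) \<and>
           is_arg_min (M_objective Z) M_feasible (M_point (\<nu>, \<alpha>)))"
proof (intro conjI allI impI)
  show "{p. M_feasible p} = {M_point (\<nu>, \<alpha>) | (\<nu> :: real ^ 'n) \<alpha>. \<alpha> \<ge> 0}"
    by (rule M_feasible_eq_M_point)
next
  fix \<nu> :: "real ^ 'n" and \<alpha> :: real
  assume "\<alpha> \<ge> 0"
  then show "M_objective Z (M_point (\<nu>, \<alpha>)) = F_objective Z (\<nu>, \<alpha>)"
    by (rule M_objective_M_point)
next
  fix \<nu> :: "real ^ 'n" and \<alpha> :: real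
  assume "(\<forall>k. \<nu> $ k = 1 / real CARD('n) * (\<Sum>j\<in>UNIV. \<nu> $ j)
                   + 1 / real CARD('n) * (\<Sum>j\<in>UNIV. center (Z $ k $ j))) \<and>
        \<alpha> = 1 / (2 * (real CARD('n))\<^sup>2) * (\<Sum>i\<in>UNIV. \<Sum>j\<in>UNIV. width (Z $ i $ j))"
  \<comment> \<open>Here \<open>m\<close> becomes the mean of \<nu>, which turns the implicit
    equation into the required form.\<close>
  then show "is_arg_min (M_objective Z) M_feasible (M_point (\<nu>, \<alpha>))"
    by (elim conjE) (rule is_arg_min_M_point[OF assms]; blast)
next
  fix \<mu> :: real
  define \<nu> :: "real ^ 'n" where
    "\<nu> = (\<chi> k. \<mu> + 1 / real CARD('n) * (\<Sum>j\<in>UNIV. center (Z $ k $ j)))"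
  have \<nu>: "\<nu> $ k = \<mu> + 1 / real CARD('n) * (\<Sum>j\<in>UNIV. center (Z $ k $ j))" for k
    unfolding \<nu>_def by (rule vec_lambda_beta)
  show "let \<nu> = (\<chi> k. \<mu> + 1 / real CARD('n) * (\<Sum>j\<in>UNIV. center (Z $ k $ j)));
            \<alpha> = 1 / (2 * (real CARD('n))\<^sup>2) * (\<Sum>i\<in>UNIV. \<Sum>j\<in>UNIV. width (Z $ i $ j))
        in (\<forall>p. is_arg_min (F_objective Z)
                  (\<lambda>(\<nu>', \<alpha>'). \<alpha>' \<ge> 0 \<and> 1 / real CARD('n) * (\<Sum>i\<in>UNIV. \<nu>' $ i) = \<mu>) p
                \<longleftrightarrow> p = (\<nu>, \<alpha>)) \<and>
           is_arg_min (M_objective Z) M_feasible (M_point (\<nu>, \<alpha>))"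
    unfolding Let_def \<nu>_def[symmetric]
    using is_arg_min_F_objective_iff[OF assms \<nu> refl] is_arg_min_M_point[OF assms \<nu> refl]
    by blast
qed

end
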